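(* Let $(C,e,\lambda,\oplus)$ be the free Catalan structure, and let $M=h\circ\mathrm{rev}\colon C\to C$, with $h$ and $\mathrm{rev}$ as defined in the context. Then $M$ is invertible and $M^{-1}=\mathrm{rev}\circ M\circ\mathrm{rev}$. In particular, $M$ is conjugate to its own inverse by $\mathrm{rev}$.
   Context: A Catalan structure is a quadruple $(C,e,\lambda,\oplus)$ where $C=\bigsqcup_{n\ge 0}C_n$ with $C_0=\{e\}$ ($|t|=n$ for $t\in C_n$), $\lambda\colon C_n\to C_{n+1}$, $\oplus\colon C_m\times C_n\to C_{m+n}$, $\oplus$ is associative with two-sided identity $e$, and every $t\in C$ can be written uniquely in exactly one of three forms: $t=e$; $t=\lambda(s)$ with $s\in C$ (indecomposable); $t=u\oplus v$ with $u$ indecomposable and $v\in C\setminus C_0$ (decomposable). Hence every nonempty $t$ is uniquely $\lambda(u)\oplus v$ ($v=e$ allowed). The free Catalan structure is realized by the formal expressions $e$, $\lambda(t)$, $\lambda(u)\oplus v$ with $v\ne e$; it is isomorphic to rooted plane trees written as lists of children, with $e=[\,]$, $\lambda(T)=[T]$, $\oplus$ = concatenation of child lists. Put $\gamma(t)=t\oplus\lambda(e)$ and define $\ominus$ by $e\ominus v=v$, $\lambda(u)\ominus v=\lambda(u\ominus v)$, $(t\oplus u)\ominus v=t\oplus(u\ominus v)$ for $t,u\ne e$ (well defined; one may take $t$ indecomposable). The maps: $h(e)=e$, $h(\lambda(u)\oplus v)=h(v)\ominus\gamma(h(u))$; $\mathrm{rev}(e)=e$, $\mathrm{rev}(\lambda(u)\oplus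 v)=\mathrm{rev}(v)\oplus\lambda(\mathrm{rev}(u))$. *)

theory Defs
  imports Main
begin

locale catalan_structure =
  fixes C :: "nat \<Rightarrow> 'a set"
    and e :: 'a
    and lam :: "'a \<Rightarrow> 'a"
    and add :: "'a \<Rightarrow> 'a \<Rightarrow> 'a"
  assumes grades_disjoint: "m \<noteq> n \<Longrightarrow> C m \<inter> C n = {}"
    and grade_0: "C 0 = {e}"
    and lam_grade: "t \<in> C n \<Longrightarrow> lam t \<in> C (n + 1)"
    and add_grade: "t \<in> C m \<Longrightarrow> u \<in> C n \<Longrightarrow> add t u \<in> C (m + n)"
    and add_assoc:
      "\<lbrakk>t \<in> (\<Union>n. C n); u \<in> (\<Union>n. C n); v \<in> (\<Union>n. C n)\<rbrakk>
        \<Longrightarrow> add (add t u) v = add t (add u v)"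
    and add_e_left: "t \<in> (\<Union>n. C n) \<Longrightarrow> add e t = t"
    and add_e_right: "t \<in> (\<Union>n. C n) \<Longrightarrow> add t e = t"
    and exhaustive:
      "t \<in> (\<Union>n. C n) \<Longrightarrow>
        t = e \<or> (\<exists>s \<in> (\<Union>n. C n). t = lam s) \<or>
        (\<exists>u \<in> lam ` (\<Union>n. C n). \<exists>v \<in> (\<Union>n. C n) - C 0. t = add u v)"
    and lam_not_e: "s \<in> (\<Union>n. C n) \<Longrightarrow> lam s \<noteq> e"
    and add_not_e:
      "\<lbrakk>u \<in> lam ` (\<Union>n. C n); v \<in> (\<Union>n. C n) - C 0\<rbrakk> \<Longrightarrow> add u v \<noteq> e"
    and add_not_lam:
      "\<lbrakk>u \<in> lam ` (\<Union>n. C n); v \<in> (\<Union>n. C n) - C 0; s \<in> (\<Union>n. C n)\<rbrakk>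
        \<Longrightarrow> add u v \<noteq> lam s"
    and lam_unique:
      "\<lbrakk>s \<in> (\<Union>n. C n); s' \<in> (\<Union>n. C n); lam s = lam s'\<rbrakk> \<Longrightarrow> s = s'"
    and add_unique:
      "\<lbrakk>u \<in> lam ` (\<Union>n. C n); v \<in> (\<Union>n. C n) - C 0;
        u' \<in> lam ` (\<Union>n. C n); v' \<in> (\<Union>n. C n) - C 0;
        add u v = add u' v'\<rbrakk> \<Longrightarrow> u = u' \<and> v = v'"

text \<open>
  The free Catalan structure, realized on rooted plane trees; a tree is given by
  the list of its children, and its degree is its number of edges.
\<close>

datatype tree = Node (children: "tree list")

definition E :: tree where
  "E = Node []"

definition Lam :: "tree \<Rightarrow> tree" where
  "Lam t = Node [t]"

definition oplus :: "tree \<Rightarrow> tree \<Rightarrow> tree" (infixr "\<oplus>" 65) where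
  "t \<oplus> u = Node (children t @ children u)"

fun edges :: "tree \<Rightarrow> nat" where
  "edges (Node []) = 0"
| "edges (Node (u # us)) = Suc (edges u) + edges (Node us)"

definition Trees :: "nat \<Rightarrow> tree set" where
  "Trees n = {t. edges t = n}"

lemma edges_oplus: "edges (t \<oplus> u) = edges t + edges u"
proof -
  have "edges (Node (xs @ ys)) = edges (Node xs) + edges (Node ys)" for xs ys
    by (induction xs) auto
  from this[of "children t" "children u"] show ?thesis
    by (simp add: oplus_def)
qed

lemma Trees_UNION: "(\<Union>n. Trees n) = UNIV"
  by (auto simp: Trees_def)

lemma Trees_0: "Trees 0 = {E}"
proof -
  have "edges t = 0 \<longleftrightarrow> t = E" for t
    by (cases t rule: edges.cases) (auto simp: E_def)
  then show ?thesis by (auto simp: Trees_def)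
qed

lemma catalan_structure_trees: "catalan_structure Trees E Lam (\<oplus>)"
proof (unfold_locales, unfold Trees_UNION Trees_0)
  fix t
  show "t = E \<or> (\<exists>s\<in>UNIV. t = Lam s) \<or> (\<exists>u\<in>range Lam. \<exists>v\<in>UNIV - {E}. t = u \<oplus> v)"
  proof (cases t rule: edges.cases)
    case 1
    then show ?thesis by (simp add: E_def)
  next
    case (2 u us)
    then have "t = Lam u \<oplus> Node us" by (simp add: Lam_def oplus_def)
    moreover have "t = Lam u" if "us = []" using 2 that by (simp add: Lam_def)
    ultimately show ?thesis by (cases "us = []") (auto simp: E_def)
  qed
qed (auto simp: Trees_def E_def Lam_def oplus_def tree.expand
  edges_oplus[unfolded oplus_def] dest: tree.expand)

text \<open>Initiality of the tree model.\<close>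

definition catalan_hom ::
  "(nat \<Rightarrow> 'a set) \<Rightarrow> 'a \<Rightarrow> ('a \<Rightarrow> 'a) \<Rightarrow> ('a \<Rightarrow> 'a \<Rightarrow> 'a) \<Rightarrow> (tree \<Rightarrow> 'a) \<Rightarrow> bool" where
  "catalan_hom C e lam add f \<longleftrightarrow>
    (\<forall>n. f ` Trees n \<subseteq> C n) \<and> f E = e \<and>
    (\<forall>t. f (Lam t) = lam (f t)) \<and> (\<forall>t u. f (t \<oplus> u) = add (f t) (f u))"

lemma trees_initial:
  assumes "catalan_structure C e lam add"
  shows "\<exists>!f. catalan_hom C e lam add f"
proof -
  interpret catalan_structure C e lam add by fact
  obtain f where f: "f (Node []) = e"
      "\<And>u us. f (Node (u # us)) = add (lam (f u)) (f (Node us))"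
  proof -
    define g where "g = rec_tree (\<lambda>ps. foldr (\<lambda>p a. add (lam (snd p)) a) ps e)"
    have "g (Node us) = foldr (\<lambda>u a. add (lam (g u)) a) us e" for us
      unfolding g_def by (induction us) auto
    then show thesis by (intro that[of g]) simp_all
  qed
  have grade: "f t \<in> C (edges t)" for t
  proof (induction t rule: edges.induct)
    case 1
    then show ?case by (simp add: f grade_0)
  next
    case (2 u us)
    then have "add (lam (f u)) (f (Node us)) \<in> C ((edges u + 1) + edges (Node us))"
      by (intro add_grade lam_grade)
    then show ?case by (simp add: f)
  qed
  then have mem: "f t \<in> (\<Union>n. C n)" for t by blast
  then have lam_mem: "lam (f t) \<in> (\<Union>n. C n)" for t
    using lam_grade[OF grade[of t]] by blast
  have "f (Node (xs @ ys)) = add (f (Node xs)) (f (Node ys))" for xs ys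
  proof (induction xs)
    case Nil
    show ?case using add_e_left[OF mem[of "Node ys"]] by (simp add: f)
  next
    case (Cons x xs)
    then show ?case
      using add_assoc[OF lam_mem mem mem, of x "Node xs" "Node ys"] by (simp add: f)
  qed
  then have "f (t \<oplus> u) = add (f t) (f u)" for t u
    by (simp add: oplus_def)
  moreover have "f (Lam t) = lam (f t)" for t
    using add_e_right[OF lam_mem[of t]] by (simp add: Lam_def f)
  moreover have "f ` Trees n \<subseteq> C n" for n
    using grade by (auto simp: Trees_def)
  ultimately have hom: "catalan_hom C e lam add f"
    by (simp add: catalan_hom_def E_def f)
  have "g = f" if g: "catalan_hom C e lam add g" for g
  proof
    fix t
    show "g t = f t"
    proof (induction t rule: edges.induct)
      case 1
      then show ?case using g hom by (simp add: catalan_hom_def E_def)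
    next
      case (2 u us)
      have "Node (u # us) = Lam u \<oplus> Node us" by (simp add: Lam_def oplus_def)
      then show ?case using 2 g hom by (simp add: catalan_hom_def)
    qed
  qed
  with hom show ?thesis by (rule ex1I)
qed

definition gam :: "tree \<Rightarrow> tree" where
  "gam t = t \<oplus> Lam E"

text \<open>
  A nonempty tree \<^term>\<open>Node (u # us)\<close> is \<^term>\<open>Lam u \<oplus> Node us\<close>, so the functions
  below recurse on the decomposition into \<open>u\<close> and \<open>v = Node us\<close>. The last equation of
  \<open>ominus\<close> is the rule for \<open>(t \<oplus> u) \<ominus> v\<close> with \<open>t\<close> indecomposable; the rule for
  general \<open>t, u \<noteq> E\<close> is derived.
\<close>

fun ominus :: "tree \<Rightarrow> tree \<Rightarrow> tree" (infixl "\<ominus>" 70) where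
  "Node [] \<ominus> v = v"
| "Node [u] \<ominus> v = Lam (u \<ominus> v)"
| "Node (t # u # us) \<ominus> v = Lam t \<oplus> (Node (u # us) \<ominus> v)"

fun h :: "tree \<Rightarrow> tree" where
  "h (Node []) = E"
| "h (Node (u # us)) = h (Node us) \<ominus> gam (h u)"

fun crev :: "tree \<Rightarrow> tree" where
  "crev (Node []) = E"
| "crev (Node (u # us)) = crev (Node us) \<oplus> Lam (crev u)"

lemma ominus_E: "E \<ominus> v = v"
  by (simp add: E_def)

lemma ominus_Lam: "Lam u \<ominus> v = Lam (u \<ominus> v)"
  by (simp add: Lam_def)

lemma ominus_oplus:
  assumes "t \<noteq> E" "u \<noteq> E"
  shows "(t \<oplus> u) \<ominus> v = t \<oplus> (u \<ominus> v)"
proof -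
  obtain y ys where u: "u = Node (y # ys)"
    using assms(2) by (cases u rule: edges.cases) (auto simp: E_def)
  have "Node (xs @ y # ys) \<ominus> v = Node xs \<oplus> (Node (y # ys) \<ominus> v)" for xs
  proof (induction xs)
    case Nil
    then show ?case by (simp add: oplus_def)
  next
    case (Cons x xs)
    then show ?case by (cases xs) (simp_all add: oplus_def Lam_def)
  qed
  from this[of "children t"] show ?thesis by (simp add: u oplus_def)
qed

lemma h_E: "h E = E"
  and h_rec: "h (Lam u \<oplus> v) = h v \<ominus> gam (h u)"
  by (simp_all add: E_def Lam_def oplus_def)

lemma crev_E: "crev E = E"
  and crev_rec: "crev (Lam u \<oplus> v) = crev v \<oplus> Lam (crev u)"
  by (simp_all add: E_def Lam_def oplus_def)

definition M :: "tree \<Rightarrow> tree" where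
  "M = h \<circ> crev"

end

(* Since rev is an involution, rev o M o rev = rev o h, so everything reduces to h being an
   involution. The grafting v \<ominus> gam u is the mirror image of Lam u \<oplus> v: besides
   h (Lam u \<oplus> v) = h v \<ominus> gam (h u) one also has h (v \<ominus> gam u) = Lam (h u) \<oplus> h v, and the two
   rules together give h o h = id by induction. *)

theory Submission
  imports Defs
begin

lemma oplus_E [simp]: "t \<oplus> E = t" "E \<oplus> t = t"
  by (simp_all add: oplus_def E_def)

lemma oplus_assoc: "(t \<oplus> u) \<oplus> v = t \<oplus> (u \<oplus> v)"
  by (simp add: oplus_def)

lemma Lam_oplus_neq_E: "Lam u \<oplus> v \<noteq> E"
  by (simp add: oplus_def Lam_def E_def)

lemma Lam_neq_E: "Lam u \<noteq> E"
  by (simp add: Lam_def E_def)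

text \<open>Induction along the unique decomposition of a nonempty tree, so that the recursions of
  \<open>crev\<close> and \<open>h\<close> apply in algebraic form.\<close>

lemma tree_induct [case_names E Lam_oplus]:
  assumes "P E" and "\<And>u v. P u \<Longrightarrow> P v \<Longrightarrow> P (Lam u \<oplus> v)"
  shows "P t"
proof (induction t rule: edges.induct)
  case 1
  then show ?case using assms(1) by (simp add: E_def)
next
  case (2 u us)
  then have "P (Lam u \<oplus> Node us)" by (rule assms(2))
  then show ?case by (simp add: Lam_def oplus_def)
qed

lemma crev_oplus: "crev (t \<oplus> u) = crev u \<oplus> crev t"
  by (induction t rule: tree_induct) (simp_all add: crev_E crev_rec oplus_assoc)

lemma crev_Lam: "crev (Lam u) = Lam (crev u)"
  using crev_rec[of u E] by (simp add: crev_E)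

lemma crev_crev: "crev (crev t) = t"
  by (induction t rule: tree_induct) (simp_all add: crev_E crev_oplus crev_Lam)

lemma h_Lam: "h (Lam u) = gam (h u)"
  using h_rec[of u E] by (simp add: h_E ominus_E)

lemma ominus_eq_E_iff: "t \<ominus> v = E \<longleftrightarrow> t = E \<and> v = E"
  by (cases "(t, v)" rule: ominus.cases) (auto simp: E_def Lam_def oplus_def)

lemma gam_neq_E: "gam t \<noteq> E"
  by (simp add: gam_def oplus_def Lam_def E_def)

text \<open>Supplies the side condition of \<open>ominus_oplus\<close> when the right summand is a
  value of \<open>h\<close>.\<close>

lemma h_eq_E_iff: "h t = E \<longleftrightarrow> t = E"
  by (induction t rule: tree_induct)
    (simp_all add: h_E h_rec ominus_eq_E_iff gam_neq_E Lam_oplus_neq_E)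

text \<open>Base case \<open>v = E\<close> of \<open>h_ominus_gam\<close>. The induction works
  because a leaf appended to \<open>Lam a \<oplus> b\<close> is appended to
  \<open>b\<close>.\<close>

lemma h_gam: "h (gam u) = Lam (h u)"
proof (induction u rule: tree_induct)
  case E
  show ?case by (simp add: gam_def h_Lam h_E)
next
  case (Lam_oplus a b)
  have "h (gam (Lam a \<oplus> b)) = h (gam b) \<ominus> gam (h a)"
    by (simp add: gam_def oplus_assoc h_rec)
  then show ?case by (simp add: Lam_oplus.IH ominus_Lam h_rec)
qed

lemma h_ominus_gam: "h (v \<ominus> gam u) = Lam (h u) \<oplus> h v"
proof (induction v rule: tree_induct)
  case E
  show ?case by (simp add: ominus_E h_gam h_E)
next
  case (Lam_oplus a b)
  show ?case
  \<comment> \<open>\<open>ominus\<close> descends into the last child, which is \<open>a\<close>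
    itself if \<open>b = E\<close> and a child of \<open>b\<close> otherwise.\<close>
  proof (cases "b = E")
    case True
    then show ?thesis
      \<comment> \<open>\<open>gam\<close> is unfolded only in the second pass, since the induction
        hypothesis for \<open>a\<close> must first match \<open>gam u\<close>.\<close>
      by (simp add: ominus_Lam h_Lam Lam_oplus.IH) (simp add: gam_def oplus_assoc)
  next
    case False
    then have "h ((Lam a \<oplus> b) \<ominus> gam u) = (Lam (h u) \<oplus> h b) \<ominus> gam (h a)"
      by (simp add: ominus_oplus Lam_neq_E h_rec Lam_oplus.IH)
    also have "\<dots> = Lam (h u) \<oplus> (h b \<ominus> gam (h a))"
      using False by (simp add: ominus_oplus Lam_neq_E h_eq_E_iff)
    finally show ?thesis by (simp add: h_rec)
  qed
qed

lemma h_h: "h (h t) = t"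
  by (induction t rule: tree_induct) (simp_all add: h_E h_rec h_ominus_gam)

theorem corollary5p6:
  "bij M \<and> inv M = crev \<circ> M \<circ> crev \<and>
   bij crev \<and> inv M = crev \<circ> M \<circ> inv crev"
proof -
  have crev: "crev \<circ> crev = id"
    by (simp add: fun_eq_iff crev_crev)
  have M: "M \<circ> (crev \<circ> M \<circ> crev) = id" "(crev \<circ> M \<circ> crev) \<circ> M = id"
    by (simp_all add: fun_eq_iff M_def crev_crev h_h)
  have "bij M" using M by (intro o_bij)
  moreover have "inv M = crev \<circ> M \<circ> crev" using M by (intro inv_unique_comp)
  moreover have "bij crev" using crev crev by (rule o_bij)
  \<comment> \<open>This turns the formula for \<open>inv M\<close> into a conjugation by
    \<open>crev\<close>.\<close>
  moreover have "inv crev = crev" using crev crev by (rule inv_unique_comp)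
  ultimately show ?thesis by simp
qed

end
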